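(* Let $a,b,c\in\mathbf{R}$ with $b<c$ and let $\Omega\subset\mathbf{R}^2$ be a domain contained in the half-strip $S:=[a,\infty)\times(b,c)$. Suppose that $u_1,u_2:\Omega\to\mathbf{R}$ are solutions of the translator equation that extend continuously to $\partial\Omega$, and suppose that $$(u_2-u_1)|_{\partial\Omega}=d$$ for some constant $d$. Suppose also that there are $x_0<\infty$ and $\epsilon$ such that, for $i=1,2$, the normal vectors $\nu_i:=\frac{(-Du_i,1)}{\sqrt{1+|Du_i|^2}}$ satisfy $$\inf_{(x,y)\in\Omega\cap\{x\ge x_0\}}\nu_i(x,y)\cdot\mathbf{e}_2>\epsilon>0.$$ Then $u_2-u_1\equiv d$ on $\Omega$.
   Context: The translator equation for a function $u$ on a planar domain is $$\operatorname{Div}\left(\frac{Du}{\sqrt{1+|Du|^2}}\right)=-\frac{1}{\sqrt{1+|Du|^2}}.$$ A domain is a nonempty connected open set. $\mathbf{e}_1,\mathbf{e}_2,\mathbf{e}_3$ is the standard basis of $\mathbf{R}^3$, and $(x,y)$ are the coordinates on $\mathbf{R}^2$. *)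

theory Defs
  imports "HOL-Analysis.Analysis"
begin

text \<open>
  Functions on a planar domain \<open>\<Omega>\<close> are total functions on \<open>real^2\<close>; the notions
  below are only applied at points of an open \<open>\<Omega>\<close>, where they do not depend on the
  values outside \<open>\<Omega>\<close>. The coordinates \<open>(x, y)\<close> of \<open>p\<close> are \<open>(p $ 1, p $ 2)\<close>.
\<close>

definition grad :: "(real^'n \<Rightarrow> real) \<Rightarrow> real^'n \<Rightarrow> real^'n" where
  "grad u p = (\<chi> i. frechet_derivative u (at p) (axis i 1))"

lemma GDERIV_grad:
  fixes u :: "real^'n \<Rightarrow> real"
  assumes "u differentiable (at p)"
  shows "GDERIV u p :> grad u p"
proof -
  let ?D = "frechet_derivative u (at p)"
  have lin: "linear ?D"
    using assms by (rule linear_frechet_derivative)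
  have "?D h = inner h (grad u p)" for h
  proof -
    have "?D h = ?D (\<Sum>i\<in>UNIV. (h $ i) *\<^sub>R axis i 1)"
      by (metis basis_expansion scalar_mult_eq_scaleR)
    also have "\<dots> = (\<Sum>i\<in>UNIV. (h $ i) *\<^sub>R ?D (axis i 1))"
      using lin by (simp add: linear_sum linear_cmul)
    also have "\<dots> = inner h (grad u p)"
      by (simp add: grad_def inner_vec_def)
    finally show ?thesis .
  qed
  then have "?D = (\<lambda>h. inner h (grad u p))"
    by (rule ext)
  with assms show ?thesis
    unfolding gderiv_def by (metis frechet_derivative_works)
qed

definition Div :: "(real^'n \<Rightarrow> real^'n) \<Rightarrow> real^'n \<Rightarrow> real" where
  "Div F p = trace (jacobian F (at p))"

text \<open>Twice continuously differentiable on an open set;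
  \<open>jacobian (grad u) (at p)\<close> is the Hessian of \<open>u\<close> at \<open>p\<close>.\<close>

definition C2_on :: "(real^'n) set \<Rightarrow> (real^'n \<Rightarrow> real) \<Rightarrow> bool" where
  "C2_on \<Omega> u \<longleftrightarrow>
     (\<forall>p\<in>\<Omega>. u differentiable (at p) \<and> grad u differentiable (at p)) \<and>
     continuous_on \<Omega> (\<lambda>p. jacobian (grad u) (at p))"

definition translator_solution :: "(real^2) set \<Rightarrow> (real^2 \<Rightarrow> real) \<Rightarrow> bool" where
  "translator_solution \<Omega> u \<longleftrightarrow>
     C2_on \<Omega> u \<and>
     (\<forall>p\<in>\<Omega>. Div (\<lambda>q. grad u q /\<^sub>R sqrt (1 + (norm (grad u q))\<^sup>2)) p
              = - (1 / sqrt (1 + (norm (grad u p))\<^sup>2)))"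

definition unit_normal :: "(real^2 \<Rightarrow> real) \<Rightarrow> real^2 \<Rightarrow> real^3" where
  "unit_normal u p =
     vector [- (grad u p $ 1), - (grad u p $ 2), 1] /\<^sub>R sqrt (1 + (norm (grad u p))\<^sup>2)"

end

theory Submission
  imports Defs
begin

text \<open>
  Write \<open>w = v2 - v1\<close>. By symmetry it is enough to prove \<open>w \<le> d\<close>. Assume otherwise. On the part of
  the closed domain with \<open>x \<le> X\<close>, which is compact, \<open>w\<close> has a maximum \<open>M > d\<close>, attained in \<open>\<Omega>\<close>. Suppose
  that also \<open>w \<le> M\<close> on the unbounded part \<open>x \<ge> X\<close>. Then \<open>M\<close> is a global maximum attained in the
  interior, which the maximum principle forbids
  (\<open>translator_comparison_strict\<close>, \<open>difference_le_frontier_bound\<close>).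

  The point is therefore to transport the bound \<open>M\<close> from the slice \<open>x = X\<close> to infinity, although
  nothing is known about \<open>w\<close> there (\<open>comparison_along_arcs\<close>, \<open>le_beyond_slice\<close>). The device is a
  rotation about a vertical axis, which is a symmetry of the translator equation. Rotate the graph
  of \<open>v1\<close> by a small angle \<open>\<theta>\<close>. A strip and its rotated copy meet in a bounded set, so \<open>v2\<close> and
  the rotated \<open>v1\<close> are compared on a bounded set, where the maximum principle applies. For
  \<open>\<theta> \<rightarrow> 0\<close> the bound for \<open>w\<close> results.

  The condition on the normals controls the boundary values in this comparison. It says that for
  \<open>x \<ge> X\<close> both functions decrease in the \<open>y\<close> direction at a rate comparable with the full
  gradient (\<open>steep_if_unit_normal\<close>). If the centre of rotation lies far enough to the left, the
  functions are therefore monotone along the arcs of rotation (\<open>nondecreasing_along_arc\<close>). Since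
  \<open>\<Omega>\<close> need not be convex in any direction, the comparison is made only at points whose whole arc of
  angle \<open>\<theta>\<close> stays in \<open>\<Omega>\<close>. At a point where this fails in the limit, the arc meets the boundary of
  \<open>\<Omega>\<close>, where \<open>w = d\<close>, and monotonicity carries this value to the two endpoints of the arc.
\<close>

section \<open>The nondivergence form of the translator equation\<close>

definition perp :: "real^2 \<Rightarrow> real^2" where
  "perp v = vector [- v $ 2, v $ 1]"

text \<open>
  The function comes with its gradient and Hessian, so that the equation is an identity between
  their values at a point. In nondivergence form the equation reads
  \<open>(1 + |Du|\<^sup>2) \<Delta>u - D\<^sup>2u(Du, Du) = - (1 + |Du|\<^sup>2)\<close>. In the plane the left side is
  \<open>\<Delta>u + D\<^sup>2u(J Du, J Du)\<close> for the quarter turn \<open>J\<close>, a sum of three pure second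
  derivatives. At a maximum of a difference each of them has a sign, which is all the
  ellipticity that is used.
\<close>

definition translator_jet ::
    "(real^2) set \<Rightarrow> (real^2 \<Rightarrow> real) \<Rightarrow> (real^2 \<Rightarrow> real^2) \<Rightarrow> (real^2 \<Rightarrow> real^2^2) \<Rightarrow> bool" where
  "translator_jet G f g H \<longleftrightarrow>
     (\<forall>p\<in>G. GDERIV f p :> g p \<and> (g has_derivative (*v) (H p)) (at p) \<and>
        trace (H p) + perp (g p) \<bullet> (H p *v perp (g p)) = - (1 + (norm (g p))\<^sup>2)) \<and>
     continuous_on G H"

lemma has_derivative_normalized_graph_gradient:
  fixes g :: "'a::real_normed_vector \<Rightarrow> 'b::real_inner"
  assumes "(g has_derivative A) (at p)"
  defines "W \<equiv> sqrt (1 + (norm (g p))\<^sup>2)"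
  shows "((\<lambda>q. g q /\<^sub>R sqrt (1 + (norm (g q))\<^sup>2)) has_derivative
           (\<lambda>h. A h /\<^sub>R W - (g p \<bullet> A h / W ^ 3) *\<^sub>R g p)) (at p)"
proof -
  have pos: "1 + g p \<bullet> g p > 0"
    by (simp add: add_pos_nonneg)
  have W: "W = sqrt (1 + g p \<bullet> g p)" "W > 0"
    using pos by (simp_all add: W_def power2_norm_eq_inner)
  have "((\<lambda>q. g q /\<^sub>R sqrt (1 + g q \<bullet> g q)) has_derivative
           (\<lambda>h. A h /\<^sub>R W - (g p \<bullet> A h / W ^ 3) *\<^sub>R g p)) (at p)"
    using pos W(2)
    by (auto intro!: derivative_eq_intros assms(1)
        simp: W(1)[symmetric] fun_eq_iff inner_commute power3_eq_cube field_simps scaleR_left.diff[symmetric])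
  then show ?thesis
    by (simp add: power2_norm_eq_inner)
qed

text \<open>The equation is multiplied by \<open>W\<^sup>3\<close>, where \<open>W\<close> is the area element
  \<open>sqrt (1 + |Du|\<^sup>2)\<close>.\<close>

lemma translator_jet_if_translator_solution:
  assumes "translator_solution \<Omega> u"
  shows "translator_jet \<Omega> u (grad u) (\<lambda>p. jacobian (grad u) (at p))"
proof -
  let ?g = "grad u" and ?H = "\<lambda>p. jacobian (grad u) (at p)"
  have C2: "u differentiable (at p)" "?g differentiable (at p)" if "p \<in> \<Omega>" for p
    using assms that by (auto simp: translator_solution_def C2_on_def)
  have "trace (?H p) + perp (?g p) \<bullet> (?H p *v perp (?g p)) = - (1 + (norm (?g p))\<^sup>2)"
    if p: "p \<in> \<Omega>" for p
  proof -
    define W where "W = sqrt (1 + (norm (?g p))\<^sup>2)"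
    have W: "W > 0" "W\<^sup>2 = 1 + (norm (?g p))\<^sup>2"
      by (simp_all add: W_def add_pos_nonneg)
    have D: "(?g has_derivative (*v) (?H p)) (at p)"
      using C2(2)[OF p] jacobian_works by blast
    have "jacobian (\<lambda>q. ?g q /\<^sub>R sqrt (1 + (norm (?g q))\<^sup>2)) (at p)
        = matrix (\<lambda>h. (?H p *v h) /\<^sub>R W - (?g p \<bullet> (?H p *v h) / W ^ 3) *\<^sub>R ?g p)"
      unfolding W_def jacobian_def
      by (subst frechet_derivative_at[symmetric,
            OF has_derivative_normalized_graph_gradient[OF D[unfolded jacobian_def]]]) simp
    then have "Div (\<lambda>q. ?g q /\<^sub>R sqrt (1 + (norm (?g q))\<^sup>2)) p
        = trace (?H p) / W - ?g p \<bullet> (?H p *v ?g p) / W ^ 3"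
      by (simp add: Div_def trace_def matrix_def sum_2 matrix_vector_mult_def inner_vec_def
          axis_def divide_inverse algebra_simps)
    then have "trace (?H p) / W - ?g p \<bullet> (?H p *v ?g p) / W ^ 3 = - (1 / W)"
      using assms p by (auto simp: translator_solution_def W_def)
    then have "W ^ 3 * (trace (?H p) / W - ?g p \<bullet> (?H p *v ?g p) / W ^ 3) = W ^ 3 * - (1 / W)"
      by (rule arg_cong)
    then have "W\<^sup>2 * trace (?H p) - ?g p \<bullet> (?H p *v ?g p) = - (W\<^sup>2)"
      using W(1) by (simp add: right_diff_distrib power2_eq_square power3_eq_cube)
    then show ?thesis
      unfolding W(2)
      by (simp add: trace_def sum_2 matrix_vector_mult_def inner_vec_def perp_def
          norm_vec_def L2_set_def power2_eq_square algebra_simps)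
  qed
  with C2 assms show ?thesis
    by (auto simp: translator_jet_def GDERIV_grad jacobian_works[symmetric]
        translator_solution_def C2_on_def)
qed

lemma translator_jet_subset:
  "translator_jet G f g H \<Longrightarrow> G' \<subseteq> G \<Longrightarrow> translator_jet G' f g H"
  by (auto simp: translator_jet_def intro: continuous_on_subset)

lemma translator_jet_cong:
  assumes "translator_jet G f g H" "open G" "\<And>p. p \<in> G \<Longrightarrow> f' p = f p"
  shows "translator_jet G f' g H"
proof -
  have "GDERIV f' p :> g p" if "p \<in> G" for p
    using assms(1,3) that has_derivative_transform_within_open[OF _ assms(2) that, where f = f and g = f']
    by (simp add: translator_jet_def gderiv_def)
  with assms(1) show ?thesis by (simp add: translator_jet_def)
qed

lemma translator_jet_continuous_on:
  assumes "translator_jet G f g H"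
  shows "continuous_on G f" "continuous_on G g" "continuous_on G H"
proof -
  have "isCont f p" "isCont g p" if "p \<in> G" for p
    using assms that has_derivative_continuous unfolding translator_jet_def gderiv_def by blast+
  then show "continuous_on G f" "continuous_on G g"
    by (simp_all add: continuous_at_imp_continuous_on)
  show "continuous_on G H"
    using assms by (simp add: translator_jet_def)
qed

section \<open>The maximum principle\<close>

lemma gradient_Hessian_at_local_max:
  fixes F :: "'a::real_inner \<Rightarrow> real"
  assumes U: "open U" "m \<in> U"
    and max: "\<And>q. q \<in> U \<Longrightarrow> F q \<le> F m"
    and grad: "\<And>q. q \<in> U \<Longrightarrow> GDERIV F q :> \<gamma> q"
    and hess: "(\<gamma> has_derivative A) (at m)"
  shows "\<gamma> m = 0" and "h \<bullet> A h \<le> 0"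
proof -
  have "(F has_derivative (\<lambda>h. h \<bullet> \<gamma> m)) (at m)"
    using grad[OF U(2)] by (simp add: gderiv_def)
  from differential_zero_maxmin[OF U(2) U(1) this] max have "(\<lambda>h. h \<bullet> \<gamma> m) = (\<lambda>v. 0)"
    by blast
  then have "\<gamma> m \<bullet> \<gamma> m = 0" by meson
  then show 0: "\<gamma> m = 0" by simp
  show "h \<bullet> A h \<le> 0"
  proof (rule ccontr)
    assume pos: "\<not> h \<bullet> A h \<le> 0"
    define l where "l s = m + s *\<^sub>R h" for s
    have l: "(l has_derivative (\<lambda>s. s *\<^sub>R h)) (at s)" for s
      unfolding l_def by (auto intro!: derivative_eq_intros)
    have l0: "l 0 = m" by (simp add: l_def)
    have "isCont l 0" using l has_derivative_continuous by blast
    then have "eventually (\<lambda>s. l s \<in> U) (at 0)"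
      using U l0 by (metis topological_tendstoD isCont_def)
    then obtain e where e: "e > 0" "\<And>s. \<bar>s\<bar> < e \<Longrightarrow> l s \<in> U"
      unfolding eventually_at by (metis U(2) dist_real_def diff_zero l0 UNIV_I)
    have d1: "((\<lambda>s. F (l s)) has_real_derivative h \<bullet> \<gamma> (l s)) (at s)" if "\<bar>s\<bar> < e" for s
    proof -
      have "(F has_derivative (\<lambda>h. h \<bullet> \<gamma> (l s))) (at (l s))"
        using grad e that by (simp add: gderiv_def)
      from has_derivative_compose[OF l this] show ?thesis
        by (simp add: has_field_derivative_def mult_commute_abs)
    qed
    have A: "linear A" using hess by (rule has_derivative_linear)
    have "((\<lambda>s. h \<bullet> \<gamma> (l s)) has_real_derivative h \<bullet> A h) (at 0)"
    proof -
      have "(\<gamma> has_derivative A) (at (l 0))" using hess l0 by simp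
      from has_derivative_compose[OF l this]
      have "((\<lambda>s. \<gamma> (l s)) has_derivative (\<lambda>s. s *\<^sub>R A h)) (at 0)"
        by (simp add: linear_cmul[OF A])
      from has_derivative_inner_right[OF this, of h] show ?thesis
        by (simp add: has_field_derivative_def mult_commute_abs)
    qed
    from DERIV_pos_inc_right[OF this] pos obtain r where
      r: "r > 0" "\<And>s. 0 < s \<Longrightarrow> s < r \<Longrightarrow> 0 < h \<bullet> \<gamma> (l s)"
      by (auto simp: l0 0)
    define s where "s = min e r / 2"
    have s: "0 < s" "s < e" "s < r" using e r by (auto simp: s_def)
    have "F (l 0) < F (l s)"
    proof (rule DERIV_pos_imp_increasing_open[OF s(1)])
      fix x assume "0 < x" "x < s"
      then show "\<exists>y. ((\<lambda>s. F (l s)) has_real_derivative y) (at x) \<and> y > 0"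
        using d1[of x] r(2)[of x] s by auto
    next
      show "continuous_on {0..s} (\<lambda>s. F (l s))"
        using s by (intro continuous_at_imp_continuous_on ballI DERIV_isCont[OF d1]) auto
    qed
    moreover have "F (l s) \<le> F m" using max e(2)[of s] s by auto
    ultimately show False by (simp add: l0)
  qed
qed

text \<open>
  A maximum principle in which the difference of the solutions may reach its maximum on the frontier,
  provided that this happens only strictly to the right of the interior maximum \<open>p\<close>. Adding
  \<open>\<delta> exp (- \<kappa> (x - x(p)))\<close> to the difference favours points on the left, so that the
  maximum moves off the frontier for small \<open>\<delta>\<close>. At the new maximum \<open>m\<close> the gradients differ by a
  vector \<open>t e\<^sub>1\<close> with \<open>t = \<delta> \<kappa> exp (- \<kappa> (x(m) - x(p)))\<close>. By the two equations, the second order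
  gain \<open>\<kappa> t\<close> of the exponential is at most a constant times \<open>t\<close>; the constant depends only on
  bounds for \<open>Df1\<close> and \<open>D\<^sup>2f1\<close> on \<open>K\<close>. This fails when \<open>\<kappa>\<close> is large.
\<close>

lemma translator_comparison_strict:
  fixes K :: "(real^2) set"
  assumes jet1: "translator_jet G f1 g1 H1" and jet2: "translator_jet G f2 g2 H2"
    and K: "compact K" "K \<subseteq> G" and p: "p \<in> K" and \<eta>: "\<eta> > 0"
    and bdry: "\<And>q. q \<in> frontier K \<Longrightarrow>
      f2 q - f1 q \<le> f2 p - f1 p - \<eta> \<or> f2 q - f1 q \<le> f2 p - f1 p \<and> p $ 1 + \<eta> \<le> q $ 1"
  shows False
proof -
  have contg: "continuous_on K g1" and contH: "continuous_on K H1"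
    using translator_jet_continuous_on[OF jet1] K(2) continuous_on_subset by blast+
  have contf: "continuous_on K (\<lambda>q. f2 q - f1 q)"
    using translator_jet_continuous_on(1)[OF jet1] translator_jet_continuous_on(1)[OF jet2] K(2)
    by (intro continuous_on_diff) (rule continuous_on_subset, assumption+)+
  obtain B1 where B1: "\<And>q. q \<in> K \<Longrightarrow> norm (g1 q) \<le> B1"
    using compact_imp_bounded[OF compact_continuous_image[OF contg K(1)]] by (auto simp: bounded_iff)
  obtain B2 where B2: "\<And>q. q \<in> K \<Longrightarrow> norm (H1 q) \<le> B2"
    using compact_imp_bounded[OF compact_continuous_image[OF contH K(1)]] by (auto simp: bounded_iff)
  obtain D where D: "\<And>q. q \<in> K \<Longrightarrow> norm q \<le> D"
    using compact_imp_bounded[OF K(1)] by (auto simp: bounded_iff)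
  define B where "B = max B1 B2"
  define R where "R = 2 * D"
  have R: "\<bar>q $ 1 - p $ 1\<bar> \<le> R" if "q \<in> K" for q
    using D[OF that] D[OF p] component_le_norm_cart[of q 1] component_le_norm_cart[of p 1]
    unfolding R_def by linarith
  have B: "\<bar>g1 q $ i\<bar> \<le> B" "\<bar>H1 q $ i $ j\<bar> \<le> B" if "q \<in> K" for q i j
    using B1[OF that] B2[OF that] component_le_norm_cart[of "g1 q" i]
      Finite_Cartesian_Product.norm_nth_le[of "H1 q" i] component_le_norm_cart[of "H1 q $ i" j]
    unfolding B_def by linarith+
  have B0: "B \<ge> 0" using B(1)[OF p, of 1] by linarith
  \<comment> \<open>\<open>\<kappa>\<close> exceeds by one the constant in the last estimate of the proof.\<close>
  define \<kappa> where "\<kappa> = (2 * B + 1) * (1 + B) + 2 * (B * B) + 1"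
  have \<kappa>: "\<kappa> > 0"
    unfolding \<kappa>_def using B0 by (intro add_nonneg_pos add_nonneg_nonneg mult_nonneg_nonneg) auto
  \<comment> \<open>The first bound in the minimum gives \<open>t \<le> 1\<close>; the second keeps the perturbation below \<open>\<eta>\<close> on \<open>K\<close>.\<close>
  define \<delta> where "\<delta> = min (1 / \<kappa>) (\<eta> / 2) * exp (- \<kappa> * R)"
  have \<delta>: "\<delta> > 0" using \<kappa> \<eta> by (simp add: \<delta>_def)
  define e where "e q = exp (- \<kappa> * (q $ 1 - p $ 1))" for q :: "real^2"
  have e_le: "e q \<le> exp (\<kappa> * R)" if "q \<in> K" for q
  proof -
    have "\<kappa> * - (q $ 1 - p $ 1) \<le> \<kappa> * R"
      using R[OF that] \<kappa> by (intro mult_left_mono) auto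
    then show ?thesis unfolding e_def by (subst exp_le_cancel_iff) (simp add: algebra_simps)
  qed
  have \<delta>e: "\<delta> * e q \<le> min (1 / \<kappa>) (\<eta> / 2)" if "q \<in> K" for q
  proof -
    have "\<delta> * e q \<le> \<delta> * exp (\<kappa> * R)"
      using e_le[OF that] \<delta> by simp
    also have "\<dots> = min (1 / \<kappa>) (\<eta> / 2)"
      by (simp add: \<delta>_def mult.assoc flip: exp_add)
    finally show ?thesis .
  qed
  define w where "w q = f2 q - f1 q + \<delta> * e q" for q
  have "continuous_on K w"
    unfolding w_def e_def by (intro continuous_intros contf)
  then obtain m where m: "m \<in> K" "\<And>q. q \<in> K \<Longrightarrow> w q \<le> w m"
    using continuous_attains_sup[OF K(1)] p by blast
  have "m \<notin> frontier K"
  proof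
    assume "m \<in> frontier K"
    from bdry[OF this] have "w m < w p"
    proof
      assume "f2 m - f1 m \<le> f2 p - f1 p - \<eta>"
      with \<delta>e[OF m(1)] \<delta> \<eta> show ?thesis
        by (simp add: w_def e_def)
    next
      assume *: "f2 m - f1 m \<le> f2 p - f1 p \<and> p $ 1 + \<eta> \<le> m $ 1"
      then have "e m < e p"
        using \<kappa> \<eta> by (simp add: e_def)
      then have "\<delta> * e m < \<delta> * e p" using \<delta> by simp
      then show ?thesis using * by (simp add: w_def)
    qed
    with m(2)[OF p] show False by simp
  qed
  then have mi: "m \<in> interior K"
    using m(1) closure_subset by (auto simp: frontier_def)
  define \<tau> where "\<tau> q = \<delta> * \<kappa> * e q" for q
  define \<gamma> where "\<gamma> q = g2 q - g1 q - \<tau> q *\<^sub>R axis 1 1" for q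
  define A where "A h = H2 m *v h - H1 m *v h + (\<kappa> * \<tau> m * h $ 1) *\<^sub>R axis 1 1" for h
  have de: "(e has_derivative (\<lambda>h. - \<kappa> * e q * h $ 1)) (at q)" for q
    unfolding e_def by (auto intro!: derivative_eq_intros bounded_linear.has_derivative[OF bounded_linear_vec_nth])
  have "GDERIV w q :> \<gamma> q" if "q \<in> interior K" for q
  proof -
    have "q \<in> G" using that K(2) interior_subset by blast
    then have "(f1 has_derivative (\<lambda>h. h \<bullet> g1 q)) (at q)" "(f2 has_derivative (\<lambda>h. h \<bullet> g2 q)) (at q)"
      using jet1 jet2 by (auto simp: translator_jet_def gderiv_def)
    then show ?thesis
      unfolding gderiv_def w_def[abs_def]
      by (auto intro!: derivative_eq_intros de
          simp: fun_eq_iff \<gamma>_def \<tau>_def inner_diff_right inner_axis algebra_simps)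
  qed
  moreover have mG: "m \<in> G" using m K by blast
  have "(\<gamma> has_derivative A) (at m)"
  proof -
    have "(g1 has_derivative (*v) (H1 m)) (at m)" "(g2 has_derivative (*v) (H2 m)) (at m)"
      using jet1 jet2 mG by (auto simp: translator_jet_def)
    then show ?thesis
      unfolding \<gamma>_def[abs_def] \<tau>_def
      by (auto intro!: derivative_eq_intros de
          simp: fun_eq_iff A_def \<tau>_def algebra_simps)
  qed
  moreover have "w q \<le> w m" if "q \<in> interior K" for q
    using that m(2) interior_subset by blast
  ultimately have \<gamma>0: "\<gamma> m = 0" and A: "\<And>h. h \<bullet> A h \<le> 0"
    using gradient_Hessian_at_local_max[OF open_interior mi, of w \<gamma> A] by auto
  define t where "t = \<tau> m"
  have t: "0 < t" "t \<le> 1"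
  proof -
    show "0 < t" using \<delta> \<kappa> by (simp add: t_def \<tau>_def e_def)
    have "\<kappa> * (\<delta> * e m) \<le> \<kappa> * (1 / \<kappa>)"
      using \<delta>e[OF m(1)] \<kappa> by (intro mult_left_mono) auto
    then show "t \<le> 1" using \<kappa> by (simp add: t_def \<tau>_def mult_ac)
  qed
  \<comment> \<open>From here on everything is an inequality between the entries of the 2-jets at \<open>m\<close>. The Hessian
    inequality is used in the two coordinate directions and in the direction of the rotated
    gradient of \<open>f2\<close>, which are the directions in the equation for \<open>f2\<close>.\<close>
  define P1 P2 where "P1 = g1 m $ 1" and "P2 = g1 m $ 2"
  define b11 b12 b21 b22 where b: "b11 = H1 m $ 1 $ 1" "b12 = H1 m $ 1 $ 2"
    "b21 = H1 m $ 2 $ 1" "b22 = H1 m $ 2 $ 2"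
  define a11 a12 a21 a22 where a: "a11 = H2 m $ 1 $ 1" "a12 = H2 m $ 1 $ 2"
    "a21 = H2 m $ 2 $ 1" "a22 = H2 m $ 2 $ 2"
  have g2: "g2 m $ 1 = P1 + t" "g2 m $ 2 = P2"
    using \<gamma>0 by (auto simp: vec_eq_iff forall_2 \<gamma>_def P1_def P2_def t_def axis_def)
  have eq1: "b11 + b22 + (P2 * P2 * b11 - P1 * P2 * (b12 + b21) + P1 * P1 * b22) = - (1 + P1 * P1 + P2 * P2)"
    using jet1 mG unfolding translator_jet_def
    by (auto simp: trace_def sum_2 perp_def matrix_vector_mult_def inner_vec_def P1_def P2_def b
        norm_vec_def L2_set_def power2_eq_square algebra_simps)
  define Q1 where "Q1 = P1 + t"
  have eq2: "a11 + a22 + (P2 * P2 * a11 - Q1 * P2 * (a12 + a21) + Q1 * Q1 * a22) = - (1 + Q1 * Q1 + P2 * P2)"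
    using jet2 mG unfolding translator_jet_def
    by (auto simp: trace_def sum_2 perp_def matrix_vector_mult_def inner_vec_def a g2 Q1_def[symmetric]
        norm_vec_def L2_set_def power2_eq_square algebra_simps)
  have i1: "a11 - b11 + \<kappa> * t \<le> 0"
    using A[of "axis 1 1"]
    by (simp add: A_def inner_vec_def sum_2 axis_def matrix_vector_mult_def a b t_def)
  have i2: "a22 - b22 \<le> 0"
    using A[of "axis 2 1"]
    by (simp add: A_def inner_vec_def sum_2 axis_def matrix_vector_mult_def a b t_def)
  have i3: "P2 * P2 * (a11 - b11) - Q1 * P2 * (a12 - b12 + a21 - b21) + Q1 * Q1 * (a22 - b22)
      + \<kappa> * t * (P2 * P2) \<le> 0"
    using A[of "vector [- P2, Q1]"]
    by (simp add: A_def inner_vec_def sum_2 axis_def matrix_vector_mult_def a b t_def algebra_simps)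
  have "\<kappa> * t * (1 + P2 * P2) \<le> t * ((2 * P1 + t) * (1 + b22) - P2 * (b12 + b21))"
    using i1 i2 i3 eq1 eq2 unfolding Q1_def by (simp add: algebra_simps)
  moreover have "\<kappa> * t * 1 \<le> \<kappa> * t * (1 + P2 * P2)"
    using \<kappa> t by (intro mult_left_mono) auto
  ultimately have "t * \<kappa> \<le> t * ((2 * P1 + t) * (1 + b22) - P2 * (b12 + b21))"
    by (simp add: mult.commute)
  then have "\<kappa> \<le> (2 * P1 + t) * (1 + b22) - P2 * (b12 + b21)"
    using t by simp
  also have "\<dots> \<le> \<bar>(2 * P1 + t) * (1 + b22)\<bar> + \<bar>P2 * (b12 + b21)\<bar>"
    by linarith
  also have "\<dots> = \<bar>2 * P1 + t\<bar> * \<bar>1 + b22\<bar> + \<bar>P2\<bar> * \<bar>b12 + b21\<bar>"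
    by (simp only: abs_mult)
  also have "\<dots> \<le> (2 * B + 1) * (1 + B) + B * (2 * B)"
  proof -
    have "\<bar>P1\<bar> \<le> B" "\<bar>P2\<bar> \<le> B" "\<bar>b12\<bar> \<le> B" "\<bar>b21\<bar> \<le> B" "\<bar>b22\<bar> \<le> B"
      using B[OF m(1)] by (simp_all add: P1_def P2_def b)
    then have "\<bar>2 * P1 + t\<bar> \<le> 2 * B + 1" "\<bar>1 + b22\<bar> \<le> 1 + B" "\<bar>P2\<bar> \<le> B" "\<bar>b12 + b21\<bar> \<le> 2 * B"
      using t by linarith+
    then show ?thesis
      using B0 by (intro add_mono mult_mono) auto
  qed
  also have "\<dots> < \<kappa>" by (simp add: \<kappa>_def)
  finally show False by simp
qed

section \<open>Rotation invariance\<close>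

definition rot_matrix :: "real \<Rightarrow> real^2^2" where
  "rot_matrix s = vector [vector [cos s, sin s], vector [- sin s, cos s]]"

text \<open>Clockwise, so that a point to the right of the centre moves down as \<open>s\<close> grows.\<close>

definition rot :: "real^2 \<Rightarrow> real \<Rightarrow> real^2 \<Rightarrow> real^2" where
  "rot z s p = z + rot_matrix s *v (p - z)"

lemma rot_nth:
  "rot z s p $ 1 = z $ 1 + cos s * (p $ 1 - z $ 1) + sin s * (p $ 2 - z $ 2)"
  "rot z s p $ 2 = z $ 2 - sin s * (p $ 1 - z $ 1) + cos s * (p $ 2 - z $ 2)"
  by (simp_all add: rot_def rot_matrix_def matrix_vector_mult_def sum_2)

lemma rot_eq_axes:
  "rot z s p = (z $ 1 + cos s * (p $ 1 - z $ 1) + sin s * (p $ 2 - z $ 2)) *\<^sub>R axis 1 1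
    + (z $ 2 - sin s * (p $ 1 - z $ 1) + cos s * (p $ 2 - z $ 2)) *\<^sub>R axis 2 1"
  by (simp add: vec_eq_iff forall_2 rot_nth axis_def)

lemma rot_0 [simp]: "rot z 0 p = p"
  by (simp add: vec_eq_iff forall_2 rot_nth)

lemma continuous_on_rot [continuous_intros]:
  fixes S :: "'a::t2_space set"
  assumes "continuous_on S f" "continuous_on S h"
  shows "continuous_on S (\<lambda>x. rot z (f x) (h x))"
  unfolding rot_eq_axes using assms by (intro continuous_intros)

lemma rot_matrix_orthogonal:
  "rot_matrix s ** transpose (rot_matrix s) = mat 1"
  by (simp add: vec_eq_iff forall_2 rot_matrix_def matrix_matrix_mult_def sum_2 transpose_def mat_def
      power2_eq_square[symmetric] mult.commute)

text \<open>Trace, inner product and quarter turn commute with rotations of the plane, and the equation is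
  built from these.\<close>

lemma translator_jet_rot:
  fixes s :: real
  assumes "translator_jet G f g H"
  defines "T \<equiv> transpose (rot_matrix s)"
  shows "translator_jet {p. rot z s p \<in> G} (\<lambda>p. f (rot z s p))
           (\<lambda>p. T *v g (rot z s p)) (\<lambda>p. T ** H (rot z s p) ** rot_matrix s)"
  unfolding translator_jet_def
proof (intro conjI ballI)
  let ?R = "rot_matrix s"
  have RT: "?R ** T = mat 1" by (simp add: T_def rot_matrix_orthogonal)
  have inner_T: "(T *v x) \<bullet> (T *v y) = x \<bullet> y" for x y
    using RT by (metis T_def dot_lmul_matrix matrix_vector_mul_assoc matrix_vector_mul_lid
        transpose_matrix_vector)
  have perp_T: "perp (T *v x) = T *v perp x" for x
    by (simp add: vec_eq_iff forall_2 perp_def T_def rot_matrix_def matrix_vector_mult_def sum_2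
        transpose_def)
  have drot: "(rot z s has_derivative (*v) ?R) (at p)" for p
    unfolding rot_def matrix_vector_mult_diff_distrib
    by (auto intro!: derivative_eq_intros
        bounded_linear_imp_has_derivative[OF matrix_vector_mul_bounded_linear])
  fix p assume "p \<in> {p. rot z s p \<in> G}"
  then have p: "(f has_derivative (\<lambda>h. h \<bullet> g (rot z s p))) (at (rot z s p))"
    "(g has_derivative (*v) (H (rot z s p))) (at (rot z s p))"
    "trace (H (rot z s p)) + perp (g (rot z s p)) \<bullet> (H (rot z s p) *v perp (g (rot z s p)))
       = - (1 + (norm (g (rot z s p)))\<^sup>2)"
    using assms by (auto simp: translator_jet_def gderiv_def)
  show "GDERIV (\<lambda>p. f (rot z s p)) p :> T *v g (rot z s p)"
    using has_derivative_compose[OF drot p(1)]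
    by (simp add: gderiv_def T_def dot_lmul_matrix inner_commute[of _ "_ v* _"]
        inner_commute[of "_ *v _"])
  show "((\<lambda>p. T *v g (rot z s p)) has_derivative (*v) (T ** H (rot z s p) ** ?R)) (at p)"
    using bounded_linear.has_derivative[OF matrix_vector_mul_bounded_linear
        has_derivative_compose[OF drot p(2)], of T]
    by (simp add: matrix_vector_mul_assoc matrix_mul_assoc)
  have "trace (T ** H (rot z s p) ** ?R) = trace (H (rot z s p))"
    by (metis RT matrix_mul_assoc matrix_mul_lid trace_mul_sym)
  moreover have "(T ** H (rot z s p) ** ?R) *v (T *v x) = T *v (H (rot z s p) *v x)" for x
    by (metis RT matrix_mul_assoc matrix_mul_rid matrix_vector_mul_assoc)
  moreover have "norm (T *v x) = norm x" for x
    by (simp add: norm_eq_sqrt_inner inner_T)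
  ultimately show "trace (T ** H (rot z s p) ** ?R)
      + perp (T *v g (rot z s p)) \<bullet> ((T ** H (rot z s p) ** ?R) *v perp (T *v g (rot z s p)))
    = - (1 + (norm (T *v g (rot z s p)))\<^sup>2)"
    using p(3) by (simp add: perp_T inner_T)
next
  let ?R = "rot_matrix s"
  let ?S = "{p. rot z s p \<in> G}"
  have H: "continuous_on ?S (\<lambda>p. H (rot z s p))"
  proof (rule continuous_on_compose2[of G H])
    show "continuous_on G H" using assms by (simp add: translator_jet_def)
    show "continuous_on ?S (rot z s)"
      by (rule continuous_on_rot[OF continuous_on_const continuous_on_id])
  qed auto
  have "continuous_on ?S (\<lambda>p. \<chi> i j. \<Sum>k\<in>UNIV. (\<Sum>l\<in>UNIV. T $ i $ l * H (rot z s p) $ l $ k) * ?R $ k $ j)"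
    by (intro continuous_on_vec_lambda continuous_on_sum continuous_on_mult continuous_on_const
        continuous_on_component H)
  then show "continuous_on ?S (\<lambda>p. T ** H (rot z s p) ** ?R)"
    by (simp add: matrix_matrix_mult_def)
qed

section \<open>Monotonicity along arcs of rotation\<close>

lemma steep_if_unit_normal:
  assumes "unit_normal u q \<bullet> axis 2 1 > \<epsilon>" "\<epsilon> > 0"
  shows "grad u q $ 2 < 0 \<and> \<epsilon> * \<bar>grad u q $ 1\<bar> \<le> - grad u q $ 2"
proof -
  define W where "W = sqrt (1 + (norm (grad u q))\<^sup>2)"
  have W: "W > 0" "norm (grad u q) \<le> W"
    unfolding W_def by (simp_all add: add_pos_nonneg real_le_rsqrt)
  have "\<epsilon> < - grad u q $ 2 / W"
    using assms(1) by (simp add: unit_normal_def inner_axis W_def[symmetric] divide_inverse mult.commute)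
  then have "\<epsilon> * W < - grad u q $ 2"
    by (simp only: pos_less_divide_eq[OF W(1)])
  moreover have "\<epsilon> * \<bar>grad u q $ 1\<bar> \<le> \<epsilon> * W"
    using assms(2) W component_le_norm_cart[of "grad u q" 1] by (intro mult_left_mono) auto
  moreover have "0 < \<epsilon> * W" using assms(2) W by simp
  ultimately show ?thesis by linarith
qed

text \<open>The distance from the centre is constant, and the height above it does not grow. Hence the
  horizontal distance does not shrink. This keeps arcs that start in \<open>x \<ge> X\<close> in that region.\<close>

lemma arc_moves_right:
  assumes "z $ 1 \<le> p $ 1" "0 \<le> s" "s \<le> pi / 2" "z $ 2 \<le> p $ 2" "z $ 2 \<le> rot z s p $ 2"
  shows "p $ 1 \<le> rot z s p $ 1"
proof -
  define \<xi> \<eta> \<xi>' \<eta>' where d: "\<xi> = p $ 1 - z $ 1" "\<eta> = p $ 2 - z $ 2"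
    "\<xi>' = rot z s p $ 1 - z $ 1" "\<eta>' = rot z s p $ 2 - z $ 2"
  have e: "\<xi>' = cos s * \<xi> + sin s * \<eta>" "\<eta>' = cos s * \<eta> - sin s * \<xi>"
    by (simp_all add: d rot_nth)
  have sc: "0 \<le> sin s" "0 \<le> cos s" "cos s \<le> 1"
    using assms by (auto intro: sin_ge_zero cos_ge_zero)
  have pos: "0 \<le> \<xi>" "0 \<le> \<eta>" "0 \<le> \<eta>'"
    using assms by (simp_all add: d)
  have "0 \<le> \<xi>'" unfolding e using sc pos by simp
  have "\<eta>' \<le> \<eta>"
    using mult_right_mono[OF sc(3) pos(2)] mult_nonneg_nonneg[OF sc(1) pos(1)] by (simp add: e)
  then have "\<eta>'\<^sup>2 \<le> \<eta>\<^sup>2"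
    using pos by (simp add: power_mono)
  moreover have "\<xi>'\<^sup>2 + \<eta>'\<^sup>2 = ((cos s)\<^sup>2 + (sin s)\<^sup>2) * (\<xi>\<^sup>2 + \<eta>\<^sup>2)"
    unfolding e by (simp add: power2_eq_square algebra_simps del: sin_cos_squared_add sin_cos_squared_add2 sin_cos_squared_add3)
  ultimately have "\<xi>\<^sup>2 \<le> \<xi>'\<^sup>2" by simp
  with \<open>0 \<le> \<xi>'\<close> have "\<xi> \<le> \<xi>'" by (rule power2_le_imp_le[rotated])
  then show ?thesis by (simp add: d)
qed

lemma has_derivative_rot_angle:
  "((\<lambda>s. rot z s p) has_derivative
     (\<lambda>h. h *\<^sub>R vector [rot z s p $ 2 - z $ 2, - (rot z s p $ 1 - z $ 1)])) (at s)"
  unfolding rot_eq_axes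
  by (auto intro!: derivative_eq_intros
      simp: fun_eq_iff vec_eq_iff forall_2 axis_def algebra_simps)

text \<open>
  The velocity of the rotation at \<open>q\<close> is \<open>(q\<^sub>2 - z\<^sub>2, - (q\<^sub>1 - z\<^sub>1))\<close>. Its first
  component is at most the width \<open>c - b\<close> of the strip, the second has size at least
  \<open>(c - b) / \<epsilon>\<close> by the choice of the centre. Since \<open>v\<close> decreases in \<open>y\<close> with
  \<open>|v\<^sub>x| \<le> |v\<^sub>y| / \<epsilon>\<close>, the downward part of the motion prevails and \<open>v\<close> grows.
\<close>

lemma nondecreasing_along_arc:
  assumes jet: "translator_jet \<Omega> v g H"
    and strip: "\<Omega> \<subseteq> {p. b < p $ 2 \<and> p $ 2 < c}"
    and steep: "\<And>q. q \<in> \<Omega> \<Longrightarrow> X \<le> q $ 1 \<Longrightarrow> g q $ 2 < 0 \<and> \<epsilon> * \<bar>g q $ 1\<bar> \<le> - g q $ 2"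
    and z: "z $ 1 = X - (c - b) / \<epsilon>" "z $ 2 = b" and "b \<le> c" "\<epsilon> > 0"
    and p: "X \<le> p $ 1" "\<And>s. 0 \<le> s \<Longrightarrow> s \<le> \<theta> \<Longrightarrow> rot z s p \<in> \<Omega>"
    and s: "0 \<le> s" "s \<le> s'" "s' \<le> \<theta>" "\<theta> \<le> pi / 2"
  shows "v (rot z s p) \<le> v (rot z s' p)"
proof (rule DERIV_nonneg_imp_nondecreasing[OF s(2), where f = "\<lambda>s. v (rot z s p)"], intro exI conjI)
  fix r assume r: "s \<le> r" "r \<le> s'"
  define q where "q = rot z r p"
  have q: "q \<in> \<Omega>" using p(2)[of r] r s by (simp add: q_def)
  have L: "(c - b) / \<epsilon> \<ge> 0" using assms by simp
  have "p \<in> \<Omega>" using p(2)[of 0] s by simp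
  then have p2: "b < p $ 2" "b < q $ 2" "q $ 2 < c" using strip q by auto
  have "p $ 1 \<le> q $ 1"
    unfolding q_def using p p2 r s z L by (intro arc_moves_right) (auto simp: q_def)
  then have qX: "X \<le> q $ 1" using p by simp
  have dv: "(v has_derivative (\<lambda>h. h \<bullet> g q)) (at q)"
    using jet q by (auto simp: translator_jet_def gderiv_def)
  show "((\<lambda>s. v (rot z s p)) has_real_derivative
      (q $ 2 - z $ 2) * g q $ 1 - (q $ 1 - z $ 1) * g q $ 2) (at r)"
    unfolding has_field_derivative_def
    by (rule has_derivative_eq_rhs[OF
          has_derivative_compose[OF has_derivative_rot_angle dv[unfolded q_def]]])
      (simp add: fun_eq_iff q_def inner_vec_def sum_2 algebra_simps)
  have "(c - b) / \<epsilon> * (\<epsilon> * \<bar>g q $ 1\<bar>) \<le> (c - b) / \<epsilon> * (- g q $ 2)"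
    using steep[OF q qX] L by (intro mult_left_mono) auto
  also have "\<dots> \<le> (q $ 1 - z $ 1) * (- g q $ 2)"
    using steep[OF q qX] qX z by (intro mult_right_mono) auto
  finally have "(c - b) * \<bar>g q $ 1\<bar> \<le> - ((q $ 1 - z $ 1) * g q $ 2)"
    using \<open>\<epsilon> > 0\<close> by simp
  moreover have "(q $ 2 - z $ 2) * \<bar>g q $ 1\<bar> \<le> (c - b) * \<bar>g q $ 1\<bar>"
    using p2 z by (intro mult_right_mono) auto
  moreover have "- ((q $ 2 - z $ 2) * g q $ 1) \<le> (q $ 2 - z $ 2) * \<bar>g q $ 1\<bar>"
    using p2 z by (metis abs_ge_minus_self abs_mult abs_of_pos diff_gt_0_iff_gt)
  ultimately show "0 \<le> (q $ 2 - z $ 2) * g q $ 1 - (q $ 1 - z $ 1) * g q $ 2"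
    by linarith
qed

definition arc_inside :: "real^2 \<Rightarrow> real \<Rightarrow> (real^2) set \<Rightarrow> (real^2) set" where
  "arc_inside z \<theta> \<Omega> = {p. \<forall>s\<in>{0..\<theta>}. rot z s p \<in> \<Omega>}"

lemma arc_inside_subset:
  assumes "0 \<le> \<theta>"
  shows "arc_inside z \<theta> \<Omega> \<subseteq> \<Omega>"
proof
  fix p assume "p \<in> arc_inside z \<theta> \<Omega>"
  with assms have "rot z 0 p \<in> \<Omega>"
    unfolding arc_inside_def by (auto simp del: rot_0)
  then show "p \<in> \<Omega>" by simp
qed

text \<open>Compactness of the range of angles makes the condition open.\<close>

lemma open_arc_inside:
  assumes "open \<Omega>"
  shows "open (arc_inside z \<theta> \<Omega>)"
proof -
  let ?T = "(\<lambda>(s, p). rot z s p) -` (- \<Omega>)"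
  have "closed ?T"
    using assms by (intro closed_vimage) (auto simp: case_prod_unfold intro!: continuous_intros)
  then have "closed {p. \<exists>s. s \<in> {0..\<theta>} \<and> (s, p) \<in> ?T}"
    by (rule closed_compact_projection[OF compact_Icc])
  moreover have "{p. \<exists>s. s \<in> {0..\<theta>} \<and> (s, p) \<in> ?T} = - arc_inside z \<theta> \<Omega>"
    by (auto simp: arc_inside_def)
  ultimately show ?thesis by (simp add: closed_open)
qed

lemma rot_tendsto:
  "P \<longlonglongrightarrow> q \<Longrightarrow> (\<lambda>n. rot z s (P n)) \<longlonglongrightarrow> rot z s q"
  unfolding rot_eq_axes by (intro tendsto_intros)

lemma rot_closure_arc_inside:
  assumes "q \<in> closure (A \<inter> arc_inside z \<theta> \<Omega>)" "0 \<le> s" "s \<le> \<theta>"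
  shows "rot z s q \<in> closure \<Omega>"
proof -
  obtain P where P: "\<And>n. P n \<in> A \<inter> arc_inside z \<theta> \<Omega>" "P \<longlonglongrightarrow> q"
    using assms(1) by (blast dest: closure_sequential[THEN iffD1])
  have "rot z s (P n) \<in> closure \<Omega>" for n
    using P(1)[of n] assms by (auto simp: arc_inside_def intro: subsetD[OF closure_subset])
  with rot_tendsto[OF P(2)] show ?thesis
    by (meson closed_closure closed_sequentially)
qed

text \<open>The monotonicity has to survive passing to limits, because a limit of arcs in the domain may
  touch the boundary, where only continuity of \<open>v\<close> is available.\<close>

lemma nondecreasing_along_limit_arc:
  assumes jet: "translator_jet \<Omega> v g H" and cont: "continuous_on (closure \<Omega>) v"
    and strip: "\<Omega> \<subseteq> {p. b < p $ 2 \<and> p $ 2 < c}"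
    and steep: "\<And>q. q \<in> \<Omega> \<Longrightarrow> X \<le> q $ 1 \<Longrightarrow> g q $ 2 < 0 \<and> \<epsilon> * \<bar>g q $ 1\<bar> \<le> - g q $ 2"
    and z: "z $ 1 = X - (c - b) / \<epsilon>" "z $ 2 = b" and "b \<le> c" "\<epsilon> > 0"
    and q: "q \<in> closure ({p. X \<le> p $ 1} \<inter> arc_inside z \<theta> \<Omega>)"
    and s: "0 \<le> s" "s \<le> s'" "s' \<le> \<theta>" "\<theta> \<le> pi / 2"
  shows "v (rot z s q) \<le> v (rot z s' q)"
proof -
  obtain P where P: "\<And>n. P n \<in> {p. X \<le> p $ 1} \<inter> arc_inside z \<theta> \<Omega>" "P \<longlonglongrightarrow> q"
    using q by (blast dest: closure_sequential[THEN iffD1])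
  have lim: "(\<lambda>n. v (rot z r (P n))) \<longlonglongrightarrow> v (rot z r q)" if "0 \<le> r" "r \<le> \<theta>" for r
  proof (rule continuous_on_tendsto_compose[OF cont rot_tendsto[OF P(2)]])
    show "rot z r q \<in> closure \<Omega>"
      using rot_closure_arc_inside[OF q that] .
    show "eventually (\<lambda>n. rot z r (P n) \<in> closure \<Omega>) sequentially"
      using P(1) that by (auto simp: arc_inside_def intro!: always_eventually subsetD[OF closure_subset])
  qed
  have "v (rot z s (P n)) \<le> v (rot z s' (P n))" for n
    using P(1)[of n]
    by (intro nondecreasing_along_arc[OF jet strip steep z \<open>b \<le> c\<close> \<open>\<epsilon> > 0\<close> _ _ s])
      (auto simp: arc_inside_def)
  with lim[of s] lim[of s'] s show ?thesis
    by (intro LIMSEQ_le[of "\<lambda>n. v (rot z s (P n))" _ "\<lambda>n. v (rot z s' (P n))"]) auto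
qed

section \<open>Transport of the bound to infinity\<close>

text \<open>
  The maximum principle is applied to \<open>v2\<close> and the rotated \<open>v1\<close> on the open set \<open>G\<close> of points
  beyond the slice whose arc stays in \<open>\<Omega>\<close>. The closure of \<open>S\<close> is compact, because the vertical
  displacement at horizontal distance \<open>r\<close> is about \<open>r sin \<theta>\<close> and cannot exceed the width of the
  strip. Outside \<open>G\<close> the bound follows from monotonicity: on the slice, rotating only increases \<open>v1\<close>,
  and if the arc of \<open>q\<close> meets the frontier at \<open>r\<close>, then
  \<open>v2 q \<le> v2 r \<le> v1 r + M \<le> v1 (rot z \<theta> q) + M\<close>.
\<close>

lemma comparison_along_arcs:
  fixes \<Omega> :: "(real^2) set" and z :: "real^2"
  assumes \<Omega>: "open \<Omega>" "\<Omega> \<subseteq> {p. b < p $ 2 \<and> p $ 2 < c}" "b \<le> c"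
    and jet1: "translator_jet \<Omega> v1 g1 H1" and jet2: "translator_jet \<Omega> v2 g2 H2"
    and cont1: "continuous_on (closure \<Omega>) v1" and cont2: "continuous_on (closure \<Omega>) v2"
    and steep1: "\<And>q. q \<in> \<Omega> \<Longrightarrow> X \<le> q $ 1 \<Longrightarrow> g1 q $ 2 < 0 \<and> \<epsilon> * \<bar>g1 q $ 1\<bar> \<le> - g1 q $ 2"
    and steep2: "\<And>q. q \<in> \<Omega> \<Longrightarrow> X \<le> q $ 1 \<Longrightarrow> g2 q $ 2 < 0 \<and> \<epsilon> * \<bar>g2 q $ 1\<bar> \<le> - g2 q $ 2"
    and \<epsilon>: "\<epsilon> > 0"
    and z: "z $ 1 = X - (c - b) / \<epsilon>" "z $ 2 = b"
    and bdry: "\<And>p. p \<in> frontier \<Omega> \<Longrightarrow> v2 p - v1 p \<le> M"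
    and slice: "\<And>p. p \<in> closure \<Omega> \<Longrightarrow> p $ 1 = X \<Longrightarrow> v2 p - v1 p \<le> M"
    and \<theta>: "0 < \<theta>" "\<theta> \<le> pi / 2"
    and p: "X \<le> p $ 1" "p \<in> arc_inside z \<theta> \<Omega>"
  shows "v2 p - v1 (rot z \<theta> p) \<le> M"
proof -
  define S where "S = {p. X \<le> p $ 1} \<inter> arc_inside z \<theta> \<Omega>"
  define G where "G = {p. X < p $ 1} \<inter> arc_inside z \<theta> \<Omega>"
  define \<Phi> where "\<Phi> q = v2 q - v1 (rot z \<theta> q)" for q
  have openG: "open G"
    unfolding G_def using \<Omega>
    by (intro open_Int open_arc_inside open_Collect_less continuous_intros)
  have GS: "G \<subseteq> S" by (auto simp: G_def S_def)
  have cl\<Omega>: "closure \<Omega> \<subseteq> {p. b \<le> p $ 2 \<and> p $ 2 \<le> c}"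
  proof (rule closure_minimal)
    show "\<Omega> \<subseteq> {p. b \<le> p $ 2 \<and> p $ 2 \<le> c}" using \<Omega> by auto
    show "closed {p::real^2. b \<le> p $ 2 \<and> p $ 2 \<le> c}"
      by (intro closed_Collect_conj closed_Collect_le continuous_intros)
  qed
  have clS1: "X \<le> q $ 1" if "q \<in> closure S" for q
  proof -
    have "closure S \<subseteq> {p. X \<le> p $ 1}"
      by (intro closure_minimal closed_Collect_le continuous_intros) (auto simp: S_def)
    with that show ?thesis by auto
  qed
  have clS2: "rot z s q \<in> closure \<Omega>" if "q \<in> closure S" "0 \<le> s" "s \<le> \<theta>" for q s
    using rot_closure_arc_inside that unfolding S_def by blast
  note mono1 = nondecreasing_along_limit_arc[OF jet1 cont1 \<Omega>(2) steep1 z \<Omega>(3) \<epsilon>]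
  note mono2 = nondecreasing_along_limit_arc[OF jet2 cont2 \<Omega>(2) steep2 z \<Omega>(3) \<epsilon>]
  have off_G: "\<Phi> q \<le> M" if q: "q \<in> closure S" "q \<notin> G" for q
  proof (cases "q $ 1 = X")
    case True
    have "v1 q \<le> v1 (rot z \<theta> q)"
      using mono1[of q \<theta> 0 \<theta>] q \<theta> by (simp add: S_def)
    moreover have "q \<in> closure \<Omega>" using clS2[OF q(1), of 0] \<theta> by simp
    ultimately show ?thesis using slice[of q] True by (simp add: \<Phi>_def)
  next
    case False
    then obtain s where s: "0 \<le> s" "s \<le> \<theta>" "rot z s q \<notin> \<Omega>"
      using q(2) clS1[OF q(1)] by (auto simp: G_def arc_inside_def)
    then have "rot z s q \<in> frontier \<Omega>"
      using clS2[OF q(1)] \<Omega>(1) by (simp add: frontier_def interior_open)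
    from bdry[OF this] have "v2 (rot z s q) - v1 (rot z s q) \<le> M" .
    moreover have "v2 q \<le> v2 (rot z s q)"
      using mono2[of q \<theta> 0 s] q s \<theta> by (simp add: S_def)
    moreover have "v1 (rot z s q) \<le> v1 (rot z \<theta> q)"
      using mono1[of q \<theta> s \<theta>] q s \<theta> by (simp add: S_def)
    ultimately show ?thesis by (simp add: \<Phi>_def)
  qed
  have sin\<theta>: "0 < sin \<theta>" using \<theta> by (intro sin_gt_zero) auto
  have compact: "compact (closure S)"
  proof -
    have "closure S \<subseteq> cbox (vector [X, b]) (vector [z $ 1 + (c - b) / sin \<theta>, c])"
    proof
      fix q assume q: "q \<in> closure S"
      have "q \<in> closure \<Omega>" "rot z \<theta> q \<in> closure \<Omega>"
        using clS2[OF q, of 0] clS2[OF q, of \<theta>] \<theta> by auto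
      then have y: "b \<le> q $ 2" "q $ 2 \<le> c" "b \<le> rot z \<theta> q $ 2" using cl\<Omega> by auto
      have "cos \<theta> * (q $ 2 - b) \<le> 1 * (q $ 2 - b)"
        using y by (intro mult_right_mono) auto
      then have "sin \<theta> * (q $ 1 - z $ 1) \<le> c - b"
        using y z by (simp add: rot_nth)
      then have "q $ 1 - z $ 1 \<le> (c - b) / sin \<theta>"
        using sin\<theta> by (simp add: field_simps)
      then show "q \<in> cbox (vector [X, b]) (vector [z $ 1 + (c - b) / sin \<theta>, c])"
        using clS1[OF q] y by (simp add: mem_box_cart forall_2)
    qed
    then show ?thesis
      by (meson bounded_cbox bounded_subset closed_closure compact_eq_bounded_closed)
  qed
  have cont\<Phi>: "continuous_on (closure S) \<Phi>"
    unfolding \<Phi>_def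
  proof (intro continuous_on_diff)
    show "continuous_on (closure S) v2"
      using clS2[of _ 0] \<theta> by (intro continuous_on_subset[OF cont2]) auto
    show "continuous_on (closure S) (\<lambda>x. v1 (rot z \<theta> x))"
      using clS2[of _ \<theta>] \<theta>
      by (intro continuous_on_compose2[OF cont1 continuous_on_rot[OF continuous_on_const continuous_on_id]])
        auto
  qed
  have pS: "p \<in> closure S"
    using p by (intro subsetD[OF closure_subset]) (auto simp: S_def arc_inside_def)
  obtain m where m: "m \<in> closure S" "\<And>q. q \<in> closure S \<Longrightarrow> \<Phi> q \<le> \<Phi> m"
    using continuous_attains_sup[OF compact _ cont\<Phi>] pS by (metis empty_iff)
  have "\<Phi> m \<le> M"
  proof (rule ccontr)
    assume "\<not> \<Phi> m \<le> M"
    define k where "k = (M + \<Phi> m) / 2"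
    have k: "M < k" "k < \<Phi> m" using \<open>\<not> \<Phi> m \<le> M\<close> by (auto simp: k_def)
    \<comment> \<open>A superlevel set above \<open>M\<close> stays away from the part of the closure outside \<open>G\<close>, and on its
      frontier the difference drops to the level \<open>k\<close>.\<close>
    define K where "K = {q \<in> closure S. k \<le> \<Phi> q}"
    have KG: "K \<subseteq> G" using off_G k by (force simp: K_def)
    have "closed K"
      unfolding K_def using continuous_closed_preimage[OF cont\<Phi>, of "{k..}"]
      by (simp add: vimage_def Int_def)
    then have cK: "compact K"
      using compact_Int_closed[OF compact, of K] by (simp add: K_def Int_def)
    have "translator_jet {p. rot z \<theta> p \<in> \<Omega>} (\<lambda>p. v1 (rot z \<theta> p))
        (\<lambda>p. transpose (rot_matrix \<theta>) *v g1 (rot z \<theta> p))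
        (\<lambda>p. transpose (rot_matrix \<theta>) ** H1 (rot z \<theta> p) ** rot_matrix \<theta>)"
      by (rule translator_jet_rot[OF jet1])
    then have jet1': "translator_jet G (\<lambda>p. v1 (rot z \<theta> p))
        (\<lambda>p. transpose (rot_matrix \<theta>) *v g1 (rot z \<theta> p))
        (\<lambda>p. transpose (rot_matrix \<theta>) ** H1 (rot z \<theta> p) ** rot_matrix \<theta>)"
      by (rule translator_jet_subset) (use \<theta> in \<open>auto simp: G_def arc_inside_def\<close>)
    have "G \<subseteq> \<Omega>"
      using arc_inside_subset[of \<theta> z \<Omega>] \<theta> by (auto simp: G_def)
    then have jet2': "translator_jet G v2 g2 H2"
      by (rule translator_jet_subset[OF jet2])
    show False
    proof (rule translator_comparison_strict[OF jet1' jet2' cK KG])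
      show "m \<in> K" using m k by (simp add: K_def)
      show "\<Phi> m - k > 0" using k by simp
      fix q assume q: "q \<in> frontier K"
      have qK: "q \<in> K" using q \<open>closed K\<close> frontier_subset_closed by blast
      have "\<Phi> q \<le> k"
      proof (rule ccontr)
        assume "\<not> \<Phi> q \<le> k"
        have "continuous_on G \<Phi>"
          by (rule continuous_on_subset[OF cont\<Phi>]) (use GS closure_subset[of S] in auto)
        then have "open (G \<inter> \<Phi> -` {k<..})"
          using openG by (simp add: continuous_on_open_vimage Int_commute)
        moreover have "G \<inter> \<Phi> -` {k<..} \<subseteq> K"
          using GS closure_subset[of S] by (auto simp: K_def)
        moreover have "q \<in> G \<inter> \<Phi> -` {k<..}"
          using \<open>\<not> \<Phi> q \<le> k\<close> qK KG by auto
        ultimately have "q \<in> interior K" by (meson interiorI)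
        then show False using q by (simp add: frontier_def)
      qed
      then show "v2 q - v1 (rot z \<theta> q) \<le> v2 m - v1 (rot z \<theta> m) - (\<Phi> m - k) \<or>
          v2 q - v1 (rot z \<theta> q) \<le> v2 m - v1 (rot z \<theta> m) \<and> m $ 1 + (\<Phi> m - k) \<le> q $ 1"
        by (simp add: \<Phi>_def)
    qed
  qed
  then show ?thesis
    using m(2)[OF pS] by (simp add: \<Phi>_def)
qed

text \<open>A point of the open set \<open>\<Omega>\<close> has its short arcs in \<open>\<Omega>\<close>, so the angle can tend to zero.\<close>

lemma le_beyond_slice:
  fixes \<Omega> :: "(real^2) set"
  assumes \<Omega>: "open \<Omega>" "\<Omega> \<subseteq> {p. b < p $ 2 \<and> p $ 2 < c}" "b \<le> c"
    and jet1: "translator_jet \<Omega> v1 g1 H1" and jet2: "translator_jet \<Omega> v2 g2 H2"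
    and cont1: "continuous_on (closure \<Omega>) v1" and cont2: "continuous_on (closure \<Omega>) v2"
    and steep1: "\<And>q. q \<in> \<Omega> \<Longrightarrow> X \<le> q $ 1 \<Longrightarrow> g1 q $ 2 < 0 \<and> \<epsilon> * \<bar>g1 q $ 1\<bar> \<le> - g1 q $ 2"
    and steep2: "\<And>q. q \<in> \<Omega> \<Longrightarrow> X \<le> q $ 1 \<Longrightarrow> g2 q $ 2 < 0 \<and> \<epsilon> * \<bar>g2 q $ 1\<bar> \<le> - g2 q $ 2"
    and \<epsilon>: "\<epsilon> > 0"
    and bdry: "\<And>p. p \<in> frontier \<Omega> \<Longrightarrow> v2 p - v1 p \<le> M"
    and slice: "\<And>p. p \<in> closure \<Omega> \<Longrightarrow> p $ 1 = X \<Longrightarrow> v2 p - v1 p \<le> M"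
    and p: "p \<in> \<Omega>" "X \<le> p $ 1"
  shows "v2 p - v1 p \<le> M"
proof -
  define z :: "real^2" where "z = vector [X - (c - b) / \<epsilon>, b]"
  have z: "z $ 1 = X - (c - b) / \<epsilon>" "z $ 2 = b" by (simp_all add: z_def)
  have "continuous_on UNIV (\<lambda>s. rot z s p)"
    by (intro continuous_intros)
  then have rot_lim: "((\<lambda>s. rot z s p) \<longlongrightarrow> p) (at 0)"
    by (metis UNIV_I continuous_on_def rot_0)
  then have "eventually (\<lambda>s. rot z s p \<in> \<Omega>) (at 0)"
    using \<Omega>(1) p(1) by (rule topological_tendstoD)
  then obtain e where e: "e > 0" "\<And>s. \<bar>s\<bar> < e \<Longrightarrow> rot z s p \<in> \<Omega>"
    unfolding eventually_at by (metis p(1) dist_real_def diff_zero rot_0 UNIV_I)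
  have "continuous_on \<Omega> v1" using cont1 closure_subset continuous_on_subset by blast
  then have "isCont v1 p" using \<Omega>(1) p(1) continuous_on_eq_continuous_at by blast
  then have "((\<lambda>s. v2 p - v1 (rot z s p)) \<longlongrightarrow> v2 p - v1 p) (at 0)"
    using rot_lim by (intro tendsto_intros isCont_tendsto_compose[of _ v1])
  then have "((\<lambda>s. v2 p - v1 (rot z s p)) \<longlongrightarrow> v2 p - v1 p) (at_right 0)"
    by (rule filterlim_mono) (auto intro: at_le)
  moreover have "eventually (\<lambda>s. v2 p - v1 (rot z s p) \<le> M) (at_right 0)"
  proof -
    have "v2 p - v1 (rot z s p) \<le> M" if "0 < s" "s < min e (pi / 2)" for s
      using that e(2) p
      by (intro comparison_along_arcs[OF \<Omega> jet1 jet2 cont1 cont2 steep1 steep2 \<epsilon> z bdry slice])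
        (auto simp: arc_inside_def)
    then show ?thesis
      unfolding eventually_at_right_field using e(1) pi_gt_zero
      by (intro exI[of _ "min e (pi / 2)"]) auto
  qed
  ultimately show ?thesis
    by (rule tendsto_upperbound) simp
qed

section \<open>Uniqueness\<close>

text \<open>
  The maximum \<open>M\<close> over \<open>x \<le> X\<close> bounds \<open>w\<close> everywhere by \<open>le_beyond_slice\<close>. On the compact set \<open>K\<close>, which
  reaches one unit further than \<open>X\<close>, the value \<open>M\<close> can be attained on the frontier only at \<open>x = X + 1\<close>,
  to the right of the maximum point \<open>m\<close>. This is the situation excluded by
  \<open>translator_comparison_strict\<close>, which spares an appeal to the strong maximum principle.
\<close>

lemma difference_le_frontier_bound:
  fixes \<Omega> :: "(real^2) set"
  assumes \<Omega>: "open \<Omega>" "\<Omega> \<subseteq> {p. a \<le> p $ 1 \<and> b < p $ 2 \<and> p $ 2 < c}" "b \<le> c"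
    and jet1: "translator_jet \<Omega> v1 g1 H1" and jet2: "translator_jet \<Omega> v2 g2 H2"
    and cont1: "continuous_on (closure \<Omega>) v1" and cont2: "continuous_on (closure \<Omega>) v2"
    and steep1: "\<And>q. q \<in> \<Omega> \<Longrightarrow> x0 \<le> q $ 1 \<Longrightarrow> g1 q $ 2 < 0 \<and> \<epsilon> * \<bar>g1 q $ 1\<bar> \<le> - g1 q $ 2"
    and steep2: "\<And>q. q \<in> \<Omega> \<Longrightarrow> x0 \<le> q $ 1 \<Longrightarrow> g2 q $ 2 < 0 \<and> \<epsilon> * \<bar>g2 q $ 1\<bar> \<le> - g2 q $ 2"
    and \<epsilon>: "\<epsilon> > 0"
    and bdry: "\<And>p. p \<in> frontier \<Omega> \<Longrightarrow> v2 p - v1 p \<le> d"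
    and p: "p \<in> \<Omega>"
  shows "v2 p - v1 p \<le> d"
proof -
  define w where "w q = v2 q - v1 q" for q
  define X where "X = max x0 (p $ 1)"
  have contw: "continuous_on (closure \<Omega>) w"
    unfolding w_def by (intro continuous_on_diff cont1 cont2)
  have compact: "compact (closure \<Omega> \<inter> {q. q $ 1 \<le> r})" for r
  proof -
    have "closure \<Omega> \<subseteq> {q. a \<le> q $ 1 \<and> b \<le> q $ 2 \<and> q $ 2 \<le> c}"
    proof (rule closure_minimal)
      show "\<Omega> \<subseteq> {q. a \<le> q $ 1 \<and> b \<le> q $ 2 \<and> q $ 2 \<le> c}" using \<Omega> by auto
      show "closed {q::real^2. a \<le> q $ 1 \<and> b \<le> q $ 2 \<and> q $ 2 \<le> c}"
        by (intro closed_Collect_conj closed_Collect_le continuous_intros)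
    qed
    then have "closure \<Omega> \<inter> {q. q $ 1 \<le> r} \<subseteq> cbox (vector [a, b]) (vector [r, c])"
      by (auto simp: mem_box_cart forall_2)
    then have "bounded (closure \<Omega> \<inter> {q. q $ 1 \<le> r})"
      using bounded_cbox bounded_subset by blast
    moreover have "closed (closure \<Omega> \<inter> {q. q $ 1 \<le> r})"
      by (intro closed_Int closed_closure closed_Collect_le continuous_intros)
    ultimately show ?thesis by (simp add: compact_eq_bounded_closed)
  qed
  have pX: "p \<in> closure \<Omega> \<inter> {q. q $ 1 \<le> X}"
    using p subsetD[OF closure_subset] by (auto simp: X_def)
  have "continuous_on (closure \<Omega> \<inter> {q. q $ 1 \<le> X}) w"
    by (rule continuous_on_subset[OF contw]) auto
  from continuous_attains_sup[OF compact _ this] pX obtain m where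
    m: "m \<in> closure \<Omega>" "m $ 1 \<le> X"
      "\<And>q. q \<in> closure \<Omega> \<Longrightarrow> q $ 1 \<le> X \<Longrightarrow> w q \<le> w m"
    by auto
  have "w m \<le> d"
  proof (rule ccontr)
    assume "\<not> w m \<le> d"
    define k where "k = (d + w m) / 2"
    have k: "d < k" "k < w m" using \<open>\<not> w m \<le> d\<close> by (auto simp: k_def)
    have closure: "q \<in> \<Omega> \<or> q \<in> frontier \<Omega>" if "q \<in> closure \<Omega>" for q
      using that \<Omega>(1) by (auto simp: frontier_def interior_open)
    have max: "w q \<le> w m" if "q \<in> closure \<Omega>" for q
    proof (cases "q \<in> \<Omega>")
      case True
      show ?thesis
      proof (cases "q $ 1 \<le> X")
        case True
        then show ?thesis using m(3) that by blast
      next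
        case False
        have strip: "\<Omega> \<subseteq> {p. b < p $ 2 \<and> p $ 2 < c}" using \<Omega>(2) by auto
        have "x0 \<le> X" by (simp add: X_def)
        have "v2 q - v1 q \<le> w m"
        proof (rule le_beyond_slice[OF \<Omega>(1) strip \<Omega>(3) jet1 jet2 cont1 cont2 _ _ \<epsilon> _ _ True])
          show "X \<le> q $ 1" using False by simp
          show "v2 r - v1 r \<le> w m" if "r \<in> frontier \<Omega>" for r
            using bdry[OF that] k by simp
          show "v2 r - v1 r \<le> w m" if "r \<in> closure \<Omega>" "r $ 1 = X" for r
            using m(3)[of r] that by (simp add: w_def)
        qed (use steep1 steep2 \<open>x0 \<le> X\<close> in auto)
        then show ?thesis by (simp add: w_def)
      qed
    next
      case False
      then have "w q \<le> d" using closure[OF that] bdry[of q] by (simp add: w_def)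
      then show ?thesis using k by simp
    qed
    define K where "K = (closure \<Omega> \<inter> {q. q $ 1 \<le> X + 1}) \<inter> {q \<in> closure \<Omega>. k \<le> w q}"
    have "closed {q \<in> closure \<Omega>. k \<le> w q}"
      using continuous_closed_preimage[OF contw, of "{k..}"] by (simp add: vimage_def Int_def)
    then have cK: "compact K"
      unfolding K_def by (rule compact_Int_closed[OF compact])
    have K\<Omega>: "K \<subseteq> \<Omega>"
    proof
      fix q assume "q \<in> K"
      then show "q \<in> \<Omega>" using closure[of q] bdry[of q] k by (auto simp: K_def w_def)
    qed
    show False
    proof (rule translator_comparison_strict[OF jet1 jet2 cK K\<Omega>])
      show "m \<in> K" using m k by (simp add: K_def)
      show "min 1 (w m - k) > 0" using k by simp
      fix q assume q: "q \<in> frontier K"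
      have qK: "q \<in> K" using q compact_imp_closed[OF cK] frontier_subset_closed by blast
      have "w q \<le> k \<or> X + 1 \<le> q $ 1"
      proof (rule ccontr)
        assume *: "\<not> (w q \<le> k \<or> X + 1 \<le> q $ 1)"
        have "continuous_on \<Omega> w"
          by (rule continuous_on_subset[OF contw closure_subset])
        then have "open (\<Omega> \<inter> w -` {k<..})"
          using \<Omega>(1) by (simp add: continuous_on_open_vimage Int_commute)
        moreover have "open {q::real^2. q $ 1 < X + 1}"
          by (intro open_Collect_less continuous_intros)
        ultimately have "open (\<Omega> \<inter> w -` {k<..} \<inter> {q. q $ 1 < X + 1})"
          by (rule open_Int)
        moreover have "\<Omega> \<inter> w -` {k<..} \<inter> {q. q $ 1 < X + 1} \<subseteq> K"
          using closure_subset[of \<Omega>] by (auto simp: K_def)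
        moreover have "q \<in> \<Omega> \<inter> w -` {k<..} \<inter> {q. q $ 1 < X + 1}"
          using * qK K\<Omega> by auto
        ultimately have "q \<in> interior K" by (meson interiorI)
        then show False using q by (simp add: frontier_def)
      qed
      then show "v2 q - v1 q \<le> v2 m - v1 m - min 1 (w m - k) \<or>
          v2 q - v1 q \<le> v2 m - v1 m \<and> m $ 1 + min 1 (w m - k) \<le> q $ 1"
        using max[of q] qK m(2) by (auto simp: K_def w_def min_def)
    qed
  qed
  then show ?thesis
    using m(3)[of p] pX by (simp add: w_def)
qed

text \<open>The continuous extensions solve the same equation in \<open>\<Omega>\<close>, and the one-sided bound applies to
  both orders of the two solutions.\<close>

theorem theorem2:
  fixes a b c d x0 \<epsilon> :: real
    and \<Omega> :: "(real^2) set"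
    and u1 u2 v1 v2 :: "real^2 \<Rightarrow> real"
  assumes "b < c"
    and "open \<Omega>" and "connected \<Omega>" and "\<Omega> \<noteq> {}"
    and "\<Omega> \<subseteq> {p. a \<le> p $ 1 \<and> b < p $ 2 \<and> p $ 2 < c}"
    and "translator_solution \<Omega> u1" and "translator_solution \<Omega> u2"
    \<comment> \<open>\<open>v1\<close>, \<open>v2\<close> are the continuous extensions of \<open>u1\<close>, \<open>u2\<close> to the closure\<close>
    and "continuous_on (closure \<Omega>) v1" and "\<forall>p\<in>\<Omega>. v1 p = u1 p"
    and "continuous_on (closure \<Omega>) v2" and "\<forall>p\<in>\<Omega>. v2 p = u2 p"
    and "\<forall>p\<in>frontier \<Omega>. v2 p - v1 p = d"
    \<comment> \<open>infima in the extended reals, so that the infimum over the empty set is \<open>\<infinity>\<close>\<close>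
    and "0 < \<epsilon>"
    and "(INF p\<in>\<Omega> \<inter> {p. x0 \<le> p $ 1}. ereal (unit_normal u1 p \<bullet> axis 2 1)) > ereal \<epsilon>"
    and "(INF p\<in>\<Omega> \<inter> {p. x0 \<le> p $ 1}. ereal (unit_normal u2 p \<bullet> axis 2 1)) > ereal \<epsilon>"
  shows "\<forall>p\<in>\<Omega>. u2 p - u1 p = d"
proof -
  have \<Omega>: "open \<Omega>" "\<Omega> \<subseteq> {p. a \<le> p $ 1 \<and> b < p $ 2 \<and> p $ 2 < c}" "b \<le> c"
    using assms by auto
  have jet1: "translator_jet \<Omega> v1 (grad u1) (\<lambda>p. jacobian (grad u1) (at p))"
    and jet2: "translator_jet \<Omega> v2 (grad u2) (\<lambda>p. jacobian (grad u2) (at p))"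
    using assms translator_jet_if_translator_solution translator_jet_cong by blast+
  have steep1: "grad u1 q $ 2 < 0 \<and> \<epsilon> * \<bar>grad u1 q $ 1\<bar> \<le> - grad u1 q $ 2"
    if "q \<in> \<Omega>" "x0 \<le> q $ 1" for q
    using less_INF_D[OF assms(14), of q] that \<open>0 < \<epsilon>\<close> by (intro steep_if_unit_normal) auto
  have steep2: "grad u2 q $ 2 < 0 \<and> \<epsilon> * \<bar>grad u2 q $ 1\<bar> \<le> - grad u2 q $ 2"
    if "q \<in> \<Omega>" "x0 \<le> q $ 1" for q
    using less_INF_D[OF assms(15), of q] that \<open>0 < \<epsilon>\<close> by (intro steep_if_unit_normal) auto
  have bdry: "v2 q - v1 q \<le> d" "v1 q - v2 q \<le> - d" if "q \<in> frontier \<Omega>" for q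
    using bspec[OF assms(12) that] by simp_all
  show ?thesis
  proof
    fix p assume p: "p \<in> \<Omega>"
    have "v2 p - v1 p \<le> d"
      by (rule difference_le_frontier_bound[OF \<Omega> jet1 jet2 assms(8,10) steep1 steep2 \<open>0 < \<epsilon>\<close> bdry(1) p])
    moreover have "v1 p - v2 p \<le> - d"
      by (rule difference_le_frontier_bound[OF \<Omega> jet2 jet1 assms(10,8) steep2 steep1 \<open>0 < \<epsilon>\<close> bdry(2) p])
    ultimately show "u2 p - u1 p = d"
      using assms(9,11) p by simp
  qed
qed

end
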